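(* Let $\gamma$ be a synchronous message-passing context in which correct processes follow the protocol, and let $R_{\mathcal P}=R(\mathcal{P},\gamma)$. Fix two sets of processes $S,T\subseteq\mathbb{P}$, for every $i\in S$ let $\varphi_i$ be an $i$-local fact in $R_{\mathcal P}$, let $\bar\varphi_c^{S}\triangleq\bigwedge_{\text{correct } i\in S}\varphi_i$, and fix a time $m\ge 0$. Assume that $\mathcal{P}$ implements a silent broadcast of $\bar\varphi_c^{S}$ from $S$ to $T$ in round $m+1$, and fix a run $r$ of $\mathcal{P}$ (i.e. $r\in R_{\mathcal P}$). Then a process $j\in T$ that receives no messages from $S$ in round $m+1$ of $r$ knows at time $m+1$ in $r$ that $\bar\varphi_c^{S}$ was true at time $m$.
   Context: **Synchronous message-passing context $\gamma$.** There is a finite set $\mathbb{P}$ of processes, each pair connected by a two-way link; receivers know the identity of the sender. Time is discrete and global, starting at $0$; round $m+1$ takes place between times $m$ and $m+1$, and a message sent at time $m$ (in round $m+1$) is received by time $m+1$. The local state $r_i(m)$ of process $i$ at time $m$ in run $r$ consists of its initial value, the time $m$, and the sequence of its actions up to time $m$, including the messages it has sent and received. A protocol is a deterministic function from local states to messages sent and decisions. In each run every process is either correct (it follows the protocol) or faulty; the context $\gamma$ specifies which failures are possible. $R(\mathcal{P},\gamma)$ is the set of all runs of $\mathcal{P}$ in $\gamma$. **Indistinguishability and knowledge.** Runs $r,r'$ are indistinguishable to $i$ at time $m$, written $r\approx_i^m r'$, if $r_i(m)=r'_i(m)$. Process $i$ *knows* $\varphi$ at time $m$ in $r\in R$ (with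 respect to a system, i.e. set of runs, $R$) iff $\varphi$ is true of all runs $r'\in R$ with $r'\approx_i^m r$. **Local facts.** An $i$-local fact is a fact whose truth at time $m$ in a run is determined by $i$'s local state at time $m$. The fact $\bar\varphi_c^{S}$ holds at time $m$ in a run $r$ iff $\varphi_i$ holds at time $m$ in $r$ for every process $i\in S$ that is correct in $r$. **$S$-$T$ silent broadcast.** $\mathcal{P}$ implements a silent broadcast of $\bar\varphi_c^{S}$ from $S$ to $T$ in round $m+1$ if in every run $r\in R_{\mathcal P}$, each correct $i\in S$ sends messages to each $j\in T$ during round $m+1$ in case $\varphi_i$ does not hold at time $m$ (including to itself, if $i\in T$). *)

theory Defs
  imports Main
begin

text \<open>Type parameters: \<open>'p\<close> processes, \<open>'v\<close> initial values, \<open>'m\<close> message contents, \<open>'d\<close> decisions.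
  Round \<open>m+1\<close> is the interval from time \<open>m\<close> to time \<open>m+1\<close>; what happens in it is
  indexed by its starting time \<open>m\<close>.\<close>

record ('p, 'm, 'd) action =
  messages :: "'p \<Rightarrow> 'm option"  \<comment> \<open>to each recipient, possibly the sender itself; \<open>None\<close> is silence\<close>
  decision :: "'d option"

record ('p, 'v, 'm, 'd) run =
  initial :: "'p \<Rightarrow> 'v"
  correct :: "'p set"  \<comment> \<open>all other processes are faulty\<close>
  acts :: "nat \<Rightarrow> 'p \<Rightarrow> ('p, 'm, 'd) action"

definition sent :: "('p, 'v, 'm, 'd) run \<Rightarrow> nat \<Rightarrow> 'p \<Rightarrow> 'p \<Rightarrow> 'm option" where
  "sent r m i j = messages (acts r m i) j"

text \<open>Links are reliable and authenticated: in round \<open>m+1\<close>, process \<open>j\<close> receives from \<open>i\<close> exactly what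
  \<open>i\<close> actually sent to \<open>j\<close> at time \<open>m\<close>. This holds whether or not \<open>i\<close> and \<open>j\<close> are correct;
  a failure changes what a process sends or decides, not what the links deliver.\<close>

definition received :: "('p, 'v, 'm, 'd) run \<Rightarrow> nat \<Rightarrow> 'p \<Rightarrow> 'p \<Rightarrow> 'm option" where
  "received r m j i = sent r m i j"

record ('p, 'v, 'm, 'd) local_state =
  init_value :: 'v
  clock :: nat
  history :: "(('p, 'm, 'd) action \<times> ('p \<Rightarrow> 'm option)) list"
    \<comment> \<open>for each completed round: own action, and the message received from each process\<close>

definition local_state :: "('p, 'v, 'm, 'd) run \<Rightarrow> 'p \<Rightarrow> nat \<Rightarrow> ('p, 'v, 'm, 'd) local_state" where
  "local_state r i m =
     \<lparr> init_value = initial r i,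
       clock = m,
       history = map (\<lambda>k. (acts r k i, received r k i)) [0..<m] \<rparr>"

type_synonym ('p, 'v, 'm, 'd) protocol =
  "'p \<Rightarrow> ('p, 'v, 'm, 'd) local_state \<Rightarrow> ('p, 'm, 'd) action"

definition follows_protocol ::
    "('p, 'v, 'm, 'd) protocol \<Rightarrow> ('p, 'v, 'm, 'd) run \<Rightarrow> 'p \<Rightarrow> bool" where
  "follows_protocol \<P> r i \<longleftrightarrow> (\<forall>m. acts r m i = \<P> i (local_state r i m))"

text \<open>The failure model may refer to the protocol: a process that crashes, for instance, behaves
  according to the protocol up to its crashing round, and then sends some of the prescribed
  messages.\<close>

record ('p, 'v, 'm, 'd) sync_context =
  possible_inits :: "('p \<Rightarrow> 'v) set"
  possible_failures :: "('p, 'v, 'm, 'd) protocol \<Rightarrow> ('p, 'v, 'm, 'd) run \<Rightarrow> bool"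

definition runs ::
    "('p, 'v, 'm, 'd) protocol \<Rightarrow> ('p, 'v, 'm, 'd) sync_context \<Rightarrow> ('p, 'v, 'm, 'd) run set" where
  "runs \<P> \<gamma> = {r. initial r \<in> possible_inits \<gamma> \<and>
                 (\<forall>i\<in>correct r. follows_protocol \<P> r i) \<and>
                 possible_failures \<gamma> \<P> r}"

definition indist ::
    "'p \<Rightarrow> nat \<Rightarrow> ('p, 'v, 'm, 'd) run \<Rightarrow> ('p, 'v, 'm, 'd) run \<Rightarrow> bool" where
  "indist i m r r' \<longleftrightarrow> local_state r i m = local_state r' i m"

definition knows ::
    "('p, 'v, 'm, 'd) run set \<Rightarrow> 'p \<Rightarrow> nat \<Rightarrow> ('p, 'v, 'm, 'd) run \<Rightarrow>
     (('p, 'v, 'm, 'd) run \<Rightarrow> bool) \<Rightarrow> bool" where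
  "knows R i m r \<psi> \<longleftrightarrow> (\<forall>r'\<in>R. indist i m r' r \<longrightarrow> \<psi> r')"

type_synonym ('p, 'v, 'm, 'd) fact = "('p, 'v, 'm, 'd) run \<Rightarrow> nat \<Rightarrow> bool"

definition local_fact ::
    "('p, 'v, 'm, 'd) run set \<Rightarrow> 'p \<Rightarrow> ('p, 'v, 'm, 'd) fact \<Rightarrow> bool" where
  "local_fact R i \<phi> \<longleftrightarrow>
     (\<forall>r\<in>R. \<forall>r'\<in>R. \<forall>m. indist i m r r' \<longrightarrow> (\<phi> r m \<longleftrightarrow> \<phi> r' m))"

definition correct_conj ::
    "'p set \<Rightarrow> ('p \<Rightarrow> ('p, 'v, 'm, 'd) fact) \<Rightarrow> ('p, 'v, 'm, 'd) fact" where
  "correct_conj S \<phi> r m \<longleftrightarrow> (\<forall>i\<in>S. i \<in> correct r \<longrightarrow> \<phi> i r m)"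

text \<open>Silent broadcast of \<open>correct_conj S \<phi>\<close> from \<open>S\<close> to \<open>T\<close> in round \<open>m+1\<close>.\<close>

definition implements_silent_broadcast ::
    "('p, 'v, 'm, 'd) run set \<Rightarrow> ('p \<Rightarrow> ('p, 'v, 'm, 'd) fact) \<Rightarrow> 'p set \<Rightarrow> 'p set \<Rightarrow> nat \<Rightarrow> bool" where
  "implements_silent_broadcast R \<phi> S T m \<longleftrightarrow>
     (\<forall>r\<in>R. \<forall>i\<in>S. i \<in> correct r \<longrightarrow> \<not> \<phi> i r m \<longrightarrow> (\<forall>j\<in>T. sent r m i j \<noteq> None))"

end

theory Submission
  imports Defs
begin

text \<open>What \<open>j\<close> receives in round \<open>m+1\<close> is part of its local state at
  time \<open>m+1\<close>. So in every run that \<open>j\<close> cannot tell from \<open>r\<close>,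
  it again hears nothing from \<open>S\<close>; a correct \<open>i\<close> in \<open>S\<close> with
  \<open>\<phi> i\<close> false at \<open>m\<close> would have broken this silence.\<close>

text \<open>The last entry of \<open>history\<close> at time \<open>Suc m\<close> records the round
  that starts at \<open>m\<close>.\<close>

lemma indist_Suc_received:
  assumes "indist j (Suc m) r r'"
  shows "received r m j = received r' m j"
  using assms by (simp add: indist_def local_state_def)

theorem theorem6:
  fixes \<P> :: "('p::finite, 'v, 'm, 'd) protocol"
    and \<gamma> :: "('p, 'v, 'm, 'd) sync_context"
    and S T :: "'p set"
    and \<phi> :: "'p \<Rightarrow> ('p, 'v, 'm, 'd) fact"
    and m :: nat
    and r :: "('p, 'v, 'm, 'd) run"
    and j :: 'p
  assumes "\<And>i. i \<in> S \<Longrightarrow> local_fact (runs \<P> \<gamma>) i (\<phi> i)"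
    and "implements_silent_broadcast (runs \<P> \<gamma>) \<phi> S T m"
    and "r \<in> runs \<P> \<gamma>"
    and "j \<in> T"
    and "\<And>i. i \<in> S \<Longrightarrow> received r m j i = None"
  shows "knows (runs \<P> \<gamma>) j (m + 1) r (\<lambda>r'. correct_conj S \<phi> r' m)"
  unfolding knows_def correct_conj_def
proof (intro ballI impI)
  fix r' i
  assume r': "r' \<in> runs \<P> \<gamma>" "indist j (m + 1) r' r" and i: "i \<in> S" "i \<in> correct r'"
  have "received r' m j = received r m j"
    using r'(2) by (intro indist_Suc_received) simp
  \<comment> \<open>Links lose nothing, so hearing nothing from \<open>i\<close> means that
    \<open>i\<close> sent nothing to \<open>j\<close>.\<close>
  then have "sent r' m i j = None"
    using assms(5) i(1) by (metis received_def)
  then show "\<phi> i r' m"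
    using assms(2,4) r'(1) i unfolding implements_silent_broadcast_def by blast
qed

end
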